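(* Let $f:\mathcal X\to\mathcal Y$ be a fixed (deterministic) function, and define the estimator $$\hat\theta^{\mathrm{PP}}:=\hat\theta_n+\hat\omega\,(\hat\theta^f_{n+N}-\hat\theta^f_n).$$ Suppose that, as $n,N\to\infty$, $n/N\to\lambda$ and $$\hat\omega\xrightarrow{p}\omega:=\frac{\mathbb E[\phi(X,Y)\,\phi^f(X)]}{\mathbb E[\phi^f(X)^2]}.$$ Then $$\sqrt n\,(\hat\theta^{\mathrm{PP}}-\theta_0)\xrightarrow{d}N\left(0,\ \mathbb E[\phi(X,Y)^2]-\frac{(\mathbb E[\phi(X,Y)\phi^f(X)])^2}{(1+\lambda)\,\mathbb E[\phi^f(X)^2]}\right).$$
   Context: Setting: $(X_1,Y_1),\dots,(X_n,Y_n)$ are i.i.d. from $\mathbb P^*=\mathbb P^*_X\mathbb P^*_{Y\mid X}$ on $\mathcal X\times\mathcal Y$, and $X_{n+1},\dots,X_{n+N}$ are i.i.d. from $\mathbb P^*_X$, independent of the labeled data. The target is $\theta_0=\theta(\mathbb P^* )\in\mathbb R$. The estimator $\hat\theta_n=\hat\theta((X_i,Y_i)_{i=1}^n)$ is asymptotically linear for $\theta_0$ with influence function $\phi(x,y)$: $$\hat\theta_n-\theta_0=\frac1n\sum_{i=1}^n\phi(X_i,Y_i)+o_p(n^{-1/2}),\quad \mathbb E[\phi(X,Y)]=0,\ \mathbb E[\phi(X,Y)^2]<\infty.$$ The same estimation procedure is applied with $f(X_i)$ in place of $Y_i$: $\hat\theta^f_n:=\hat\theta((X_i,f(X_i))_{i=1}^n)$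 and $\hat\theta^f_{n+N}:=\hat\theta((X_i,f(X_i))_{i=1}^{n+N})$. These are asymptotically linear for $\theta_0^f:=\theta(\mathbb P^*_{X,f(X)})$ (assumed well defined and finite), where $\mathbb P^*_{X,f(X)}$ is the law of $(X,f(X))$, with influence function $\phi^f(x)$ (written $\phi(x,f(x))$ in the paper; it is the influence function of the same procedure under the law of $(X,f(X))$): $$\hat\theta_n^f-\theta_0^f=\frac1n\sum_{i=1}^n\phi^f(X_i)+o_p(n^{-1/2}),\quad \hat\theta_{n+N}^f-\theta_0^f=\frac1{n+N}\sum_{i=1}^{n+N}\phi^f(X_i)+o_p(n^{-1/2}),$$ with $\mathbb E[\phi^f(X)]=0$ and $0<\mathbb E[\phi^f(X)^2]<\infty$ (no first-order degeneracy). Expectations are under $(X,Y)\sim\mathbb P^*$, and $0\le\lambda<\infty$. *)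

theory Defs
  imports "HOL-Probability.Probability"
begin

definition normal_law :: "real \<Rightarrow> real \<Rightarrow> real measure" where
  "normal_law \<mu> v = (if v = 0 then return borel \<mu> else density lborel (normal_density \<mu> (sqrt v)))"
  (* v is the variance.  normal_density at standard deviation 0 is the zero function,
     so the degenerate law has to be given separately. *)

text \<open>The index k below runs through a sequence of experiments, each with its own probability
  space \<open>M k\<close>; convergence in probability to a constant makes sense across different spaces.\<close>

definition conv_in_prob :: "(nat \<Rightarrow> 'w measure) \<Rightarrow> (nat \<Rightarrow> 'w \<Rightarrow> real) \<Rightarrow> real \<Rightarrow> bool" where
  "conv_in_prob M Z c \<longleftrightarrow>
     (\<forall>\<epsilon>>0. (\<lambda>k. measure (M k) {w \<in> space (M k). \<bar>Z k w - c\<bar> > \<epsilon>}) \<longlonglongrightarrow> 0)"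

definition small_op :: "(nat \<Rightarrow> 'w measure) \<Rightarrow> (nat \<Rightarrow> real) \<Rightarrow> (nat \<Rightarrow> 'w \<Rightarrow> real) \<Rightarrow> bool" where
  "small_op M r R \<longleftrightarrow> conv_in_prob M (\<lambda>k w. R k w / r k) 0"

text \<open>Independence of the labeled and the unlabeled part is stated through the generated
  sigma-algebras, since \<open>indep_var\<close> requires both variables to have the same value type.\<close>

definition semisupervised_sample ::
  "'w measure \<Rightarrow> 'x measure \<Rightarrow> 'y measure \<Rightarrow> ('x \<times> 'y) measure \<Rightarrow> nat \<Rightarrow> nat
    \<Rightarrow> (nat \<Rightarrow> 'w \<Rightarrow> 'x) \<Rightarrow> (nat \<Rightarrow> 'w \<Rightarrow> 'y) \<Rightarrow> bool" where
  "semisupervised_sample M SX SY P n N X Y \<longleftrightarrow>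
     prob_space M \<and>
     prob_space.indep_vars M (\<lambda>_. SX \<Otimes>\<^sub>M SY) (\<lambda>i w. (X i w, Y i w)) {1..n} \<and>
     (\<forall>i\<in>{1..n}. distr M (SX \<Otimes>\<^sub>M SY) (\<lambda>w. (X i w, Y i w)) = P) \<and>
     prob_space.indep_vars M (\<lambda>_. SX) X {n+1..n+N} \<and>
     (\<forall>i\<in>{n+1..n+N}. distr M SX (X i) = distr P SX fst) \<and>
     prob_space.indep_set M
       (sets (vimage_algebra (space M) (\<lambda>w. \<lambda>i\<in>{1..n}. (X i w, Y i w))
                (Pi\<^sub>M {1..n} (\<lambda>_. SX \<Otimes>\<^sub>M SY))))
       (sets (vimage_algebra (space M) (\<lambda>w. \<lambda>i\<in>{n+1..n+N}. X i w)
                (Pi\<^sub>M {n+1..n+N} (\<lambda>_. SX))))"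

text \<open>An estimation procedure \<open>T\<close> takes a sample size \<open>m\<close> and a sample indexed by \<open>{1..m}\<close>,
  encoded as a point of the product space \<open>Pi\<^sub>M {1..m}\<close>.\<close>

definition estimate :: "(nat \<Rightarrow> (nat \<Rightarrow> 'd) \<Rightarrow> real) \<Rightarrow> nat \<Rightarrow> (nat \<Rightarrow> 'd) \<Rightarrow> real" where
  "estimate T m d = T m (\<lambda>i\<in>{1..m}. d i)"

definition pp_estimate ::
  "(nat \<Rightarrow> (nat \<Rightarrow> 'x \<times> 'y) \<Rightarrow> real) \<Rightarrow> ('x \<Rightarrow> 'y) \<Rightarrow> nat \<Rightarrow> nat
    \<Rightarrow> (nat \<Rightarrow> 'x) \<Rightarrow> (nat \<Rightarrow> 'y) \<Rightarrow> real \<Rightarrow> real" where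
  "pp_estimate T f n N x y \<omega> =
     estimate T n (\<lambda>i. (x i, y i))
     + \<omega> * (estimate T (n + N) (\<lambda>i. (x i, f (x i))) - estimate T n (\<lambda>i. (x i, f (x i))))"

end

theory Submission
  imports Defs
begin

text \<open>Write \<open>\<tau> = 1 / (1 + lam)\<close> and \<open>c = sqrt lam / (1 + lam)\<close>. Inserting the linear expansions splits the
  centred and scaled estimator into
  \<open>(1 / sqrt n) (\<Sum> labeled. \<phi> - \<omega> \<tau> \<phi>f) + \<omega> c (1 / sqrt N) (\<Sum> unlabeled. \<phi>f)\<close>
  and a remainder that tends to 0 in probability: besides the linearisation errors it only contains
  normalised sums with bounded second moments, and their coefficients tend to 0 in probability. The two sums are independent, so the characteristic function
  of the main term factorises and converges to a Gaussian one. The remainder does not change its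
  limit, and Levy's continuity theorem applies. The variance comes out as stated because of
  \<open>\<tau>\<^sup>2 + c\<^sup>2 = \<tau>\<close>.\<close>

section \<open>Convergence and boundedness in probability along a sequence of spaces\<close>

text \<open>The bound is asked only for eventually all \<open>k\<close>. Convergence in probability
  controls no single \<open>k\<close>, so this is the form of tightness that it implies, and limits
  need no more.\<close>

definition bounded_in_prob :: "(nat \<Rightarrow> 'w measure) \<Rightarrow> (nat \<Rightarrow> 'w \<Rightarrow> real) \<Rightarrow> bool" where
  "bounded_in_prob M Z \<longleftrightarrow>
     (\<forall>\<eta>>0. \<exists>K. \<forall>\<^sub>F k in sequentially. measure (M k) {w \<in> space (M k). \<bar>Z k w\<bar> > K} < \<eta>)"

text \<open>Measures are nonnegative, so the distance to 0 is the measure itself. In this form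
  several tolerances can be combined by \<open>eventually_elim\<close>.\<close>

lemma conv_in_prob_alt:
  "conv_in_prob M Z c \<longleftrightarrow>
     (\<forall>\<epsilon>>0. \<forall>\<eta>>0. \<forall>\<^sub>F k in sequentially. measure (M k) {w \<in> space (M k). \<bar>Z k w - c\<bar> > \<epsilon>} < \<eta>)"
  unfolding conv_in_prob_def tendsto_iff by simp

lemma conv_in_probD:
  assumes "conv_in_prob M Z c" "\<epsilon> > 0" "\<eta> > 0"
  shows "\<forall>\<^sub>F k in sequentially. measure (M k) {w \<in> space (M k). \<bar>Z k w - c\<bar> > \<epsilon>} < \<eta>"
  using assms unfolding conv_in_prob_alt by blast

lemma bounded_in_probD:
  assumes "bounded_in_prob M Z" "\<eta> > 0"
  obtains K where "\<forall>\<^sub>F k in sequentially. measure (M k) {w \<in> space (M k). \<bar>Z k w\<bar> > K} < \<eta>"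
  using assms unfolding bounded_in_prob_def by blast

lemma conv_in_prob_shift: "conv_in_prob M (\<lambda>k w. Z k w - c) 0 \<longleftrightarrow> conv_in_prob M Z c"
  by (simp add: conv_in_prob_def)

lemma conv_in_prob_minus:
  assumes "conv_in_prob M Z 0"
  shows "conv_in_prob M (\<lambda>k w. - Z k w) 0"
  using assms by (simp add: conv_in_prob_def)

text \<open>The exceptional event is eventually empty. This brings numerical coefficients into the
  same calculus as random factors.\<close>

lemma conv_in_prob_deterministic:
  assumes "a \<longlonglongrightarrow> c"
  shows "conv_in_prob M (\<lambda>k w. a k) c"
  unfolding conv_in_prob_def
proof (intro allI impI)
  fix \<epsilon> :: real assume "\<epsilon> > 0"
  with assms have "\<forall>\<^sub>F k in sequentially. \<bar>a k - c\<bar> < \<epsilon>"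
    by (auto simp: tendsto_iff dist_real_def)
  then have "\<forall>\<^sub>F k in sequentially. measure (M k) {w \<in> space (M k). \<bar>a k - c\<bar> > \<epsilon>} = 0"
    by eventually_elim simp
  then show "(\<lambda>k. measure (M k) {w \<in> space (M k). \<bar>a k - c\<bar> > \<epsilon>}) \<longlonglongrightarrow> 0"
    by (rule tendsto_eventually)
qed

text \<open>Where \<open>\<bar>Z k w\<bar>\<close> exceeds \<open>\<bar>c\<bar> + 1\<close>, the
  distance to \<open>c\<close> exceeds 1, so the single tolerance 1 suffices.\<close>

lemma conv_in_prob_imp_bounded_in_prob:
  assumes prob: "\<And>k. prob_space (M k)" and meas: "\<And>k. Z k \<in> borel_measurable (M k)"
    and conv: "conv_in_prob M Z c"
  shows "bounded_in_prob M Z"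
  unfolding bounded_in_prob_def
proof (intro allI impI)
  fix \<eta> :: real assume \<eta>: "\<eta> > 0"
  have "\<forall>\<^sub>F k in sequentially. measure (M k) {w \<in> space (M k). \<bar>Z k w\<bar> > \<bar>c\<bar> + 1} < \<eta>"
    using conv_in_probD[OF conv zero_less_one \<eta>]
  proof eventually_elim
    case (elim k)
    interpret prob_space "M k" by (rule prob)
    have [measurable]: "Z k \<in> borel_measurable (M k)" by (rule meas)
    have "measure (M k) {w \<in> space (M k). \<bar>Z k w\<bar> > \<bar>c\<bar> + 1}
        \<le> measure (M k) {w \<in> space (M k). \<bar>Z k w - c\<bar> > 1}"
      by (rule finite_measure_mono) auto
    with elim show ?case by linarith
  qed
  then show "\<exists>K. \<forall>\<^sub>F k in sequentially. measure (M k) {w \<in> space (M k). \<bar>Z k w\<bar> > K} < \<eta>"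
    by blast
qed

text \<open>Chebyshev's argument: Markov's inequality for the square, with the same \<open>K\<close>
  for every \<open>k\<close>.\<close>

lemma bounded_in_prob_second_moment:
  assumes prob: "\<And>k. prob_space (M k)" and meas: "\<And>k. Z k \<in> borel_measurable (M k)"
    and int: "\<And>k. integrable (M k) (\<lambda>w. (Z k w)\<^sup>2)"
    and bound: "\<And>k. (\<integral>w. (Z k w)\<^sup>2 \<partial>M k) \<le> C"
  shows "bounded_in_prob M Z"
  unfolding bounded_in_prob_def
proof (intro allI impI)
  fix \<eta> :: real assume \<eta>: "\<eta> > 0"
  have "0 \<le> (\<integral>w. (Z 0 w)\<^sup>2 \<partial>M 0)" by simp
  with bound[of 0] have "C \<ge> 0" by linarith
  \<comment> \<open>The value makes \<open>C / K\<^sup>2\<close> strictly smaller than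
    \<open>\<eta>\<close>; the summand 1 keeps \<open>K\<close> positive when \<open>C\<close> is
    0.\<close>
  define K where "K = sqrt (C / \<eta> + 1)"
  have K: "K > 0" "K\<^sup>2 = C / \<eta> + 1" using \<open>C \<ge> 0\<close> \<eta> by (auto simp: K_def add_nonneg_pos)
  have "measure (M k) {w \<in> space (M k). \<bar>Z k w\<bar> > K} < \<eta>" for k
  proof -
    interpret prob_space "M k" by (rule prob)
    have [measurable]: "Z k \<in> borel_measurable (M k)" by (rule meas)
    have "measure (M k) {w \<in> space (M k). \<bar>Z k w\<bar> > K}
        \<le> measure (M k) {w \<in> space (M k). (Z k w)\<^sup>2 \<ge> K\<^sup>2}"
      using \<open>K > 0\<close> by (intro finite_measure_mono) (auto simp: abs_le_square_iff[symmetric])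
    also have "\<dots> \<le> (\<integral>w. (Z k w)\<^sup>2 \<partial>M k) / K\<^sup>2"
      using \<open>K > 0\<close> by (intro integral_Markov_inequality_measure[where A="{}"] int) auto
    also have "\<dots> \<le> C / K\<^sup>2" using bound by (intro divide_right_mono) auto
    also have "\<dots> < \<eta>" using \<eta> \<open>C \<ge> 0\<close> unfolding K(2) by (simp add: field_simps add_nonneg_pos)
    finally show ?thesis .
  qed
  then show "\<exists>K. \<forall>\<^sub>F k in sequentially. measure (M k) {w \<in> space (M k). \<bar>Z k w\<bar> > K} < \<eta>"
    by (intro exI[of _ K] always_eventually allI)
qed

text \<open>If both deviations are at most \<open>\<epsilon> / 2\<close>, the deviation of the sum
  is at most \<open>\<epsilon>\<close>; a union bound does the rest.\<close>

lemma conv_in_prob_add: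
  assumes prob: "\<And>k. prob_space (M k)"
    and meas: "\<And>k. Z k \<in> borel_measurable (M k)" "\<And>k. W k \<in> borel_measurable (M k)"
    and conv: "conv_in_prob M Z a" "conv_in_prob M W b"
  shows "conv_in_prob M (\<lambda>k w. Z k w + W k w) (a + b)"
  unfolding conv_in_prob_alt
proof (intro allI impI)
  fix \<epsilon> \<eta> :: real assume "\<epsilon> > 0" "\<eta> > 0"
  then have "\<epsilon> / 2 > 0" "\<eta> / 2 > 0" by auto
  from conv_in_probD[OF conv(1) this] conv_in_probD[OF conv(2) this]
  show "\<forall>\<^sub>F k in sequentially. measure (M k) {w \<in> space (M k). \<bar>Z k w + W k w - (a + b)\<bar> > \<epsilon>} < \<eta>"
  proof eventually_elim
    case (elim k)
    interpret prob_space "M k" by (rule prob)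
    have [measurable]: "Z k \<in> borel_measurable (M k)" "W k \<in> borel_measurable (M k)"
      by (rule meas)+
    have "measure (M k) {w \<in> space (M k). \<bar>Z k w + W k w - (a + b)\<bar> > \<epsilon>}
        \<le> measure (M k) ({w \<in> space (M k). \<bar>Z k w - a\<bar> > \<epsilon> / 2} \<union> {w \<in> space (M k). \<bar>W k w - b\<bar> > \<epsilon> / 2})"
      by (rule finite_measure_mono) (auto, argo)
    also have "\<dots> \<le> measure (M k) {w \<in> space (M k). \<bar>Z k w - a\<bar> > \<epsilon> / 2}
        + measure (M k) {w \<in> space (M k). \<bar>W k w - b\<bar> > \<epsilon> / 2}"
      by (rule measure_Un_le) auto
    finally show ?case using elim by linarith
  qed
qed

text \<open>Off two events of small probability, one factor is at most \<open>K\<close> and the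
  other at most \<open>\<epsilon> / L\<close>. All products in the remainder are handled by this
  rule.\<close>

lemma conv_in_prob_0_mult_bounded:
  assumes prob: "\<And>k. prob_space (M k)"
    and meas: "\<And>k. Z k \<in> borel_measurable (M k)" "\<And>k. W k \<in> borel_measurable (M k)"
    and conv: "conv_in_prob M Z 0" and bdd: "bounded_in_prob M W"
  shows "conv_in_prob M (\<lambda>k w. Z k w * W k w) 0"
  unfolding conv_in_prob_alt
proof (intro allI impI)
  fix \<epsilon> \<eta> :: real assume pos: "\<epsilon> > 0" "\<eta> > 0"
  then have \<eta>2: "\<eta> / 2 > 0" by simp
  obtain K where K: "\<forall>\<^sub>F k in sequentially. measure (M k) {w \<in> space (M k). \<bar>W k w\<bar> > K} < \<eta> / 2"
    using bounded_in_probD[OF bdd \<eta>2] .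
  \<comment> \<open>The bound \<open>K\<close> might be zero or negative, so a positive majorant is
    needed before dividing by it.\<close>
  define L where "L = max K 1"
  have L: "L > 0" "K \<le> L" by (auto simp: L_def)
  have "\<epsilon> / L > 0" using pos L by simp
  from K conv_in_probD[OF conv this \<eta>2]
  show "\<forall>\<^sub>F k in sequentially. measure (M k) {w \<in> space (M k). \<bar>Z k w * W k w - 0\<bar> > \<epsilon>} < \<eta>"
  proof eventually_elim
    case (elim k)
    interpret prob_space "M k" by (rule prob)
    have [measurable]: "Z k \<in> borel_measurable (M k)" "W k \<in> borel_measurable (M k)"
      by (rule meas)+
    have *: "\<bar>z * v\<bar> \<le> \<epsilon>" if "\<bar>z\<bar> \<le> \<epsilon> / L" "\<bar>v\<bar> \<le> K" for z v :: real
    proof -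
      have "\<bar>z\<bar> * \<bar>v\<bar> \<le> \<epsilon> / L * L" using that L by (intro mult_mono) auto
      then show ?thesis using L by (simp add: abs_mult)
    qed
    have "measure (M k) {w \<in> space (M k). \<bar>Z k w * W k w - 0\<bar> > \<epsilon>}
        \<le> measure (M k) ({w \<in> space (M k). \<bar>W k w\<bar> > K} \<union> {w \<in> space (M k). \<bar>Z k w - 0\<bar> > \<epsilon> / L})"
      using * by (intro finite_measure_mono) (auto simp: not_less[symmetric])
    also have "\<dots> \<le> measure (M k) {w \<in> space (M k). \<bar>W k w\<bar> > K}
        + measure (M k) {w \<in> space (M k). \<bar>Z k w - 0\<bar> > \<epsilon> / L}"
      by (rule measure_Un_le) auto
    finally show ?case using elim by linarith
  qed
qed

section \<open>Characteristic functions: small perturbations, normal laws, the central limit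
  theorem\<close>

text \<open>Slutsky's theorem for characteristic functions. The integrands differ in modulus by
  \<open>norm (iexp (t * R k w) - 1)\<close>, which is at most \<open>\<bar>t * R k w\<bar>\<close>
  and at most 2; the first bound serves where \<open>R\<close> is small, the second on the rare
  remaining event.\<close>

lemma char_add_conv_in_prob_0:
  assumes prob: "\<And>k. prob_space (M k)"
    and meas: "\<And>k. Z k \<in> borel_measurable (M k)" "\<And>k. R k \<in> borel_measurable (M k)"
    and conv: "conv_in_prob M R 0"
  shows "(\<lambda>k. char (distr (M k) borel (\<lambda>w. Z k w + R k w)) t - char (distr (M k) borel (Z k)) t) \<longlonglongrightarrow> 0"
proof (rule tendstoI)
  fix \<eta> :: real assume \<eta>: "\<eta> > 0"
  \<comment> \<open>The good event contributes at most \<open>\<bar>t\<bar> * \<epsilon>\<close>,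
    hence at most \<open>\<eta> / 2\<close>; adding 1 to \<open>\<bar>t\<bar>\<close> covers
    \<open>t = 0\<close>. The bad event, of probability below \<open>\<eta> / 4\<close>, contributes
    less than the other half.\<close>
  define \<epsilon> where "\<epsilon> = \<eta> / (2 * (\<bar>t\<bar> + 1))"
  have \<epsilon>: "\<epsilon> > 0" "\<bar>t\<bar> * \<epsilon> \<le> \<eta> / 2" using \<eta> by (auto simp: \<epsilon>_def field_simps)
  have "\<eta> / 4 > 0" using \<eta> by simp
  from conv_in_probD[OF conv \<epsilon>(1) this]
  show "\<forall>\<^sub>F k in sequentially. dist (char (distr (M k) borel (\<lambda>w. Z k w + R k w)) t
      - char (distr (M k) borel (Z k)) t) 0 < \<eta>"
  proof eventually_elim
    case (elim k)
    interpret prob_space "M k" by (rule prob)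
    have [measurable]: "Z k \<in> borel_measurable (M k)" "R k \<in> borel_measurable (M k)"
      by (rule meas)+
    let ?B = "{w \<in> space (M k). \<bar>R k w - 0\<bar> > \<epsilon>}"
    have int: "integrable (M k) (\<lambda>w. iexp (t * h w))" if [measurable]: "h \<in> borel_measurable (M k)" for h
      by (intro integrable_iexp) auto
    have "char (distr (M k) borel (\<lambda>w. Z k w + R k w)) t - char (distr (M k) borel (Z k)) t
        = (CLINT w|M k. iexp (t * (Z k w + R k w)) - iexp (t * Z k w))"
      unfolding char_def by (simp add: integral_distr int Bochner_Integration.integral_diff del: of_real_add of_real_mult)
    also have "norm \<dots> \<le> (\<integral>w. norm (iexp (t * (Z k w + R k w)) - iexp (t * Z k w)) \<partial>M k)"
      by (rule integral_norm_bound)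
    also have "\<dots> \<le> (\<integral>w. \<eta> / 2 + 2 * indicator ?B w \<partial>M k)"
    proof (intro integral_mono)
      show "integrable (M k) (\<lambda>w. norm (iexp (t * (Z k w + R k w)) - iexp (t * Z k w)))"
        by (intro integrable_norm Bochner_Integration.integrable_diff int) auto
      show "integrable (M k) (\<lambda>w. \<eta> / 2 + 2 * indicator ?B w :: real)"
        by (auto intro!: Bochner_Integration.integrable_add integrable_mult_right
              integrable_real_indicator simp: emeasure_eq_measure)
      fix w assume w: "w \<in> space (M k)"
      have "iexp (t * (Z k w + R k w)) - iexp (t * Z k w) = iexp (t * Z k w) * (iexp (t * R k w) - 1)"
        by (simp add: algebra_simps exp_add[symmetric])
      then have eq: "norm (iexp (t * (Z k w + R k w)) - iexp (t * Z k w)) = norm (iexp (t * R k w) - 1)"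
        by (simp add: norm_mult del: of_real_mult)
      show "norm (iexp (t * (Z k w + R k w)) - iexp (t * Z k w)) \<le> \<eta> / 2 + 2 * indicator ?B w"
      proof (cases "\<bar>R k w\<bar> > \<epsilon>")
        case True
        have "norm (iexp (t * R k w) - 1) \<le> 2"
          using norm_triangle_ineq4[of "iexp (t * R k w)" 1] by (simp del: of_real_mult)
        with True w \<eta> show ?thesis unfolding eq by simp
      next
        case False
        have "norm (iexp (t * R k w) - 1) \<le> \<bar>t * R k w\<bar>"
          using iexp_approx1[of "t * R k w" 0] by simp
        also have "\<dots> \<le> \<bar>t\<bar> * \<epsilon>" using False by (auto simp: abs_mult intro!: mult_left_mono)
        finally show ?thesis unfolding eq using \<epsilon> False by simp
      qed
    qed
    also have "\<dots> = \<eta> / 2 + 2 * measure (M k) ?B"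
      by (subst Bochner_Integration.integral_add)
         (auto simp: prob_space emeasure_eq_measure intro!: integrable_mult_right integrable_real_indicator)
    also have "\<dots> < \<eta>" using elim by linarith
    finally show ?case by simp
  qed
qed

lemma real_distribution_normal_law:
  assumes "v \<ge> 0"
  shows "real_distribution (normal_law \<mu> v)"
proof (cases "v = 0")
  case True
  then show ?thesis
    by (auto simp: normal_law_def real_distribution_def real_distribution_axioms_def intro!: prob_space_return)
next
  case False
  with assms show ?thesis
    by (auto simp: normal_law_def real_distribution_def real_distribution_axioms_def intro!: prob_space_normal_density)
qed

text \<open>For positive variance the law is the standard normal scaled by \<open>sqrt v\<close>.
  The point mass at \<open>v = 0\<close> obeys the same formula, so later arguments need no case
  distinction.\<close>

lemma char_normal_law_0:
  assumes "v \<ge> 0"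
  shows "char (normal_law 0 v) t = complex_of_real (exp (- (v * t\<^sup>2) / 2))"
proof (cases "v = 0")
  case True
  then show ?thesis by (simp add: normal_law_def char_def integral_return)
next
  case False
  with assms have v: "v > 0" by simp
  interpret S: prob_space std_normal_distribution by (rule prob_space_normal_density) simp
  have id: "distributed std_normal_distribution lborel (\<lambda>x. x) std_normal_density"
    by (auto simp: distributed_def distr_id2)
  from S.normal_density_affine[OF this, of "sqrt v" 0] v
  have "distributed std_normal_distribution lborel (\<lambda>x. sqrt v * x) (normal_density 0 (sqrt v))"
    by simp
  then have "distr std_normal_distribution lborel (\<lambda>x. sqrt v * x) = density lborel (normal_density 0 (sqrt v))"
    by (simp add: distributed_def)
  then have "normal_law 0 v = distr std_normal_distribution lborel (\<lambda>x. sqrt v * x)"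
    using v by (simp add: normal_law_def)
  then have "char (normal_law 0 v) t = (CLINT x|std_normal_distribution. iexp (t * (sqrt v * x)))"
    unfolding char_def by (simp add: integral_distr)
  also have "\<dots> = char std_normal_distribution (t * sqrt v)"
    unfolding char_def by (simp add: ac_simps)
  also have "\<dots> = complex_of_real (exp (- (v * t\<^sup>2) / 2))"
    using v by (simp add: char_std_normal_distribution power_mult_distrib ac_simps)
  finally show ?thesis .
qed

text \<open>Central limit theorem as a statement about powers: a second-order expansion compares the
  characteristic function with \<open>1 - v * t\<^sup>2 / (2 * n)\<close>, whose \<open>n\<close>-th
  power tends to the Gaussian exponential. No random variables occur, so the limit can be composed
  with any sample sizes tending to infinity, on changing spaces. Variance 0 is included.\<close>

lemma char_power_tendsto:
  assumes \<mu>: "real_distribution \<mu>"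
    and mean: "(LINT x|\<mu>. x) = 0"
    and sq: "integrable \<mu> (\<lambda>x. x\<^sup>2)"
  shows "(\<lambda>n. char \<mu> (t / sqrt (real n)) ^ n) \<longlonglongrightarrow>
    complex_of_real (exp (- ((LINT x|\<mu>. x\<^sup>2) * t\<^sup>2) / 2))"
proof -
  interpret \<mu>: real_distribution \<mu> by (rule \<mu>)
  define v where "v = (LINT x|\<mu>. x\<^sup>2)"
  have "v \<ge> 0" unfolding v_def by simp
  have int: "integrable \<mu> (\<lambda>x. x)"
    by (rule \<mu>.square_integrable_imp_integrable[OF _ sq]) simp
  \<comment> \<open>The integral in the error bound of \<open>char_approx3\<close>. Its integrand is
    dominated by \<open>6 * x\<^sup>2\<close> and tends to 0 pointwise, so a finite second moment is
    enough.\<close>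
  define I where "I n = (LINT x|\<mu>. min (6 * x\<^sup>2) (\<bar>t / sqrt (real n)\<bar> * \<bar>x\<bar> ^ 3))" for n
  have main: "\<forall>\<^sub>F n in sequentially.
      cmod (char \<mu> (t / sqrt (real n)) ^ n - complex_of_real ((1 + (- (v * t\<^sup>2) / 2) / real n) ^ n))
        \<le> t\<^sup>2 / 6 * I n"
  proof (rule eventually_sequentiallyI)
    fix n :: nat
    \<comment> \<open>This threshold puts \<open>1 - v * t\<^sup>2 / (2 * n)\<close> into the
      interval from -1 to 1, as \<open>norm_power_diff\<close> requires both bases to have modulus
      at most 1; \<open>Suc\<close> makes \<open>n\<close> positive.\<close>
    assume "n \<ge> Suc (nat \<lceil>v * t\<^sup>2 / 4\<rceil>)"
    then have n: "real n \<ge> v * t\<^sup>2 / 4" "n > 0" by linarith+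
    let ?t = "t / sqrt (real n)"
    have t2: "?t\<^sup>2 = t\<^sup>2 / real n" using n by (simp add: power_divide)
    have "cmod (char \<mu> ?t - (1 - ?t\<^sup>2 * v / 2)) \<le> ?t\<^sup>2 / 6 * I n"
      unfolding I_def
      by (rule \<mu>.char_approx3) (use int mean sq in \<open>auto simp: v_def\<close>)
    also have "1 - ?t\<^sup>2 * v / 2 = 1 + (- (v * t\<^sup>2) / 2) / real n"
      unfolding t2 by (simp add: ac_simps)
    finally have *: "cmod (char \<mu> ?t - complex_of_real (1 + (- (v * t\<^sup>2) / 2) / real n)) \<le> ?t\<^sup>2 / 6 * I n" .
    have "\<bar>1 + (- (v * t\<^sup>2) / 2) / real n\<bar> \<le> 1"
      using n \<open>v \<ge> 0\<close> by (auto simp: abs_le_iff field_simps)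
    then have "cmod (complex_of_real (1 + (- (v * t\<^sup>2) / 2) / real n)) \<le> 1"
      by (simp only: norm_of_real)
    then have "cmod (char \<mu> ?t ^ n - complex_of_real (1 + (- (v * t\<^sup>2) / 2) / real n) ^ n)
        \<le> n * cmod (char \<mu> ?t - complex_of_real (1 + (- (v * t\<^sup>2) / 2) / real n))"
      by (intro norm_power_diff \<mu>.cmod_char_le_1)
    \<comment> \<open>The factor \<open>n\<close> lost in comparing powers is cancelled by
      \<open>?t\<^sup>2 = t\<^sup>2 / n\<close>, which leaves only the vanishing
      \<open>I n\<close>.\<close>
    also have "\<dots> \<le> n * (?t\<^sup>2 / 6 * I n)"
      by (rule mult_left_mono[OF *]) simp
    also have "\<dots> = t\<^sup>2 / 6 * I n"
      unfolding t2 using n by simp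
    finally show "cmod (char \<mu> ?t ^ n - complex_of_real ((1 + (- (v * t\<^sup>2) / 2) / real n) ^ n))
        \<le> t\<^sup>2 / 6 * I n" by simp
  qed
  have "(\<lambda>n. t / sqrt (real n)) \<longlonglongrightarrow> 0"
    by (intro tendsto_divide_0[OF tendsto_const] filterlim_at_top_imp_at_infinity
          filterlim_compose[OF sqrt_at_top filterlim_real_sequentially])
  then have "(\<lambda>n. min (6 * x\<^sup>2) (\<bar>t / sqrt (real n)\<bar> * \<bar>x\<bar> ^ 3))
      \<longlonglongrightarrow> min (6 * x\<^sup>2) (\<bar>0\<bar> * \<bar>x\<bar> ^ 3)" for x
    by (intro tendsto_min tendsto_mult tendsto_rabs tendsto_const)
  then have "(\<lambda>n. min (6 * x\<^sup>2) (\<bar>t / sqrt (real n)\<bar> * \<bar>x\<bar> ^ 3)) \<longlonglongrightarrow> 0" for x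
    by simp
  then have "I \<longlonglongrightarrow> (LINT x|\<mu>. 0)"
    unfolding I_def
    by (intro integral_dominated_convergence[where w = "\<lambda>x. 6 * x\<^sup>2"]) (auto simp: sq)
  then have lim0: "(\<lambda>n. t\<^sup>2 / 6 * I n) \<longlonglongrightarrow> 0"
    by (simp add: tendsto_mult_right_zero)
  have "(\<lambda>n. complex_of_real ((1 + (- (v * t\<^sup>2) / 2) / real n) ^ n)) \<longlonglongrightarrow>
      complex_of_real (exp (- (v * t\<^sup>2) / 2))"
    by (rule isCont_tendsto_compose[OF _ tendsto_exp_limit_sequentially]) auto
  then show ?thesis
    unfolding v_def[symmetric] by (rule Lim_transform) (rule Lim_null_comparison[OF main lim0])
qed

section \<open>Moments and characteristic functions of independent sums\<close>

text \<open>Induction on the index set: the new summand is independent of the sum of the others, so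
  the cross term has expectation a product of means, which is 0.\<close>

lemma (in prob_space) indep_vars_centered_sum:
  fixes Z :: "'i \<Rightarrow> 'a \<Rightarrow> real"
  assumes "finite I" and indep: "indep_vars (\<lambda>_. borel) Z I"
    and "\<And>i. i \<in> I \<Longrightarrow> integrable M (\<lambda>w. (Z i w)\<^sup>2)"
    and "\<And>i. i \<in> I \<Longrightarrow> expectation (Z i) = 0"
  shows "integrable M (\<lambda>w. (\<Sum>i\<in>I. Z i w)\<^sup>2)"
    and "expectation (\<lambda>w. (\<Sum>i\<in>I. Z i w)\<^sup>2) = (\<Sum>i\<in>I. expectation (\<lambda>w. (Z i w)\<^sup>2))"
proof -
  have "integrable M (\<lambda>w. (\<Sum>i\<in>I. Z i w)\<^sup>2) \<and>
    expectation (\<lambda>w. (\<Sum>i\<in>I. Z i w)\<^sup>2) = (\<Sum>i\<in>I. expectation (\<lambda>w. (Z i w)\<^sup>2))"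
    using assms
  proof (induction I rule: finite_induct)
    case empty
    show ?case by simp
  next
    case (insert j J)
    let ?S = "\<lambda>w. \<Sum>i\<in>J. Z i w"
    have IH: "integrable M (\<lambda>w. (?S w)\<^sup>2)"
        "expectation (\<lambda>w. (?S w)\<^sup>2) = (\<Sum>i\<in>J. expectation (\<lambda>w. (Z i w)\<^sup>2))"
      using insert.IH[OF indep_vars_subset[OF insert.prems(1) subset_insertI]] insert.prems(2,3)
      by blast+
    have meas: "random_variable borel (Z i)" if "i \<in> insert j J" for i
      using insert.prems(1) that by (auto simp: indep_vars_def2)
    have ind: "indep_var borel (Z j) borel ?S"
      by (rule indep_vars_sum[OF insert.hyps insert.prems(1)])
    have Zj: "integrable M (Z j)"
      by (rule square_integrable_imp_integrable[OF meas insert.prems(2)]) simp_all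
    have S: "integrable M ?S"
      by (rule square_integrable_imp_integrable[OF borel_measurable_sum IH(1)]) (simp add: meas)
    have prod: "integrable M (\<lambda>w. Z j w * ?S w)" "expectation (\<lambda>w. Z j w * ?S w) = 0"
      using indep_var_integrable[OF ind Zj S] indep_var_lebesgue_integral[OF ind Zj S] insert.prems(3)[of j]
      by auto
    have eq: "(\<Sum>i\<in>insert j J. Z i w)\<^sup>2 = (Z j w)\<^sup>2 + (2 * (Z j w * ?S w) + (?S w)\<^sup>2)" for w
      using insert.hyps by (simp add: power2_sum)
    show ?case
      unfolding eq using prod IH insert.prems(2)[of j] insert.hyps by simp
  qed
  then show "integrable M (\<lambda>w. (\<Sum>i\<in>I. Z i w)\<^sup>2)"
    and "expectation (\<lambda>w. (\<Sum>i\<in>I. Z i w)\<^sup>2) = (\<Sum>i\<in>I. expectation (\<lambda>w. (Z i w)\<^sup>2))"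
    by auto
qed

text \<open>Transfer to the common law \<open>Q\<close> gives each summand mean 0 and the same
  second moment. This later bounds normalised sums uniformly in \<open>k\<close>.\<close>

lemma (in prob_space) iid_centered_sum:
  fixes g :: "'b \<Rightarrow> real"
  assumes "finite I" and indep: "indep_vars (\<lambda>_. S) Z I"
    and law: "\<And>i. i \<in> I \<Longrightarrow> distr M S (Z i) = Q"
    and g: "g \<in> borel_measurable S" and sq: "integrable Q (\<lambda>z. (g z)\<^sup>2)" and mean: "(\<integral>z. g z \<partial>Q) = 0"
  shows "integrable M (\<lambda>w. (\<Sum>i\<in>I. g (Z i w))\<^sup>2)"
    and "expectation (\<lambda>w. (\<Sum>i\<in>I. g (Z i w))\<^sup>2) = real (card I) * (\<integral>z. (g z)\<^sup>2 \<partial>Q)"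
proof -
  have meas[measurable]: "random_variable S (Z i)" if "i \<in> I" for i
    using indep that by (auto simp: indep_vars_def2)
  note g[measurable]
  have int: "integrable M (\<lambda>w. (g (Z i w))\<^sup>2)" if "i \<in> I" for i
    using sq meas[OF that] unfolding law[OF that, symmetric] by (simp add: integrable_distr_eq)
  have E: "expectation (\<lambda>w. (g (Z i w))\<^sup>2) = (\<integral>z. (g z)\<^sup>2 \<partial>Q)" "expectation (\<lambda>w. g (Z i w)) = 0"
    if "i \<in> I" for i
    using mean meas[OF that] unfolding law[OF that, symmetric] by (simp_all add: integral_distr)
  have ind: "indep_vars (\<lambda>_. borel) (\<lambda>i w. g (Z i w)) I"
    by (rule indep_vars_compose2[OF indep]) simp
  show "integrable M (\<lambda>w. (\<Sum>i\<in>I. g (Z i w))\<^sup>2)"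
    using indep_vars_centered_sum(1)[OF \<open>finite I\<close> ind int E(2)] .
  show "expectation (\<lambda>w. (\<Sum>i\<in>I. g (Z i w))\<^sup>2) = real (card I) * (\<integral>z. (g z)\<^sup>2 \<partial>Q)"
    using indep_vars_centered_sum(2)[OF \<open>finite I\<close> ind int E(2)] E(1) by simp
qed

text \<open>Independence multiplies the characteristic functions of the summands, and the common law
  makes all factors equal.\<close>

lemma (in prob_space) char_iid_sum:
  fixes g :: "'b \<Rightarrow> real"
  assumes indep: "indep_vars (\<lambda>_. S) Z I"
    and law: "\<And>i. i \<in> I \<Longrightarrow> distr M S (Z i) = Q"
    and g: "g \<in> borel_measurable S"
  shows "char (distr M borel (\<lambda>w. c * (\<Sum>i\<in>I. g (Z i w)))) t = char (distr Q borel g) (c * t) ^ card I"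
proof -
  note g[measurable]
  have ind: "indep_vars (\<lambda>_. borel) (\<lambda>i w. c * g (Z i w)) I"
    by (rule indep_vars_compose2[OF indep]) simp
  have "char (distr M borel (\<lambda>w. c * g (Z i w))) t = char (distr Q borel g) (c * t)" if "i \<in> I" for i
  proof -
    have [measurable]: "random_variable S (Z i)"
      using indep that by (auto simp: indep_vars_def2)
    show ?thesis
      unfolding law[OF that, symmetric] char_def by (simp add: integral_distr ac_simps)
  qed
  then show ?thesis
    using char_distr_sum[OF ind, of t] by (simp add: sum_distrib_left)
qed

text \<open>A measurable function of \<open>F\<close> generates a sub-sigma-algebra of the one
  generated by \<open>F\<close>, likewise for \<open>G\<close>, and independence passes to smaller
  families. This turns the independence clause of \<open>semisupervised_sample\<close> into one for
  real-valued statistics.\<close>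

lemma (in prob_space) indep_var_if_indep_vimage_algebra:
  assumes F: "F \<in> measurable M MF" and G: "G \<in> measurable M MG"
    and u: "u \<in> measurable MF S" and v: "v \<in> measurable MG T"
    and ind: "indep_set (sets (vimage_algebra (space M) F MF)) (sets (vimage_algebra (space M) G MG))"
  shows "indep_var S (\<lambda>w. u (F w)) T (\<lambda>w. v (G w))"
proof -
  have sub: "sigma_sets (space M) {(\<lambda>w. h (H w)) -` A \<inter> space M | A. A \<in> sets K}
      \<subseteq> sets (vimage_algebra (space M) H MH)"
    if H: "H \<in> measurable M MH" and h: "h \<in> measurable MH K" for H MH h K
  proof -
    let ?V = "vimage_algebra (space M) H MH"
    have "H \<in> measurable ?V MH"
      using H by (intro measurable_vimage_algebra1) (auto dest: measurable_space)
    then have "(\<lambda>w. h (H w)) \<in> measurable ?V K"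
      using h by (rule measurable_compose)
    then have "{(\<lambda>w. h (H w)) -` A \<inter> space M | A. A \<in> sets K} \<subseteq> sets ?V"
      by (auto dest: measurable_sets)
    then show ?thesis
      using sets.sigma_sets_subset[of _ ?V] by simp
  qed
  have "indep_set (sigma_sets (space M) {(\<lambda>w. u (F w)) -` A \<inter> space M | A. A \<in> sets S})
      (sigma_sets (space M) {(\<lambda>w. v (G w)) -` A \<inter> space M | A. A \<in> sets T})"
    using ind unfolding indep_set_def
    by (rule indep_sets_mono_sets) (use sub[OF F u] sub[OF G v] in \<open>simp split: bool.split\<close>)
  then show ?thesis
    unfolding indep_var_eq using measurable_compose[OF F u] measurable_compose[OF G v] by blast
qed

text \<open>Split the product into \<open>(Z k w - a) * \<alpha> k\<close>, a null factor times a
  bounded one, and the deterministic \<open>a * \<alpha> k\<close>.\<close>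

lemma conv_in_prob_mult_deterministic:
  assumes prob: "\<And>k. prob_space (M k)" and meas: "\<And>k. Z k \<in> borel_measurable (M k)"
    and conv: "conv_in_prob M Z a" and lim: "\<alpha> \<longlonglongrightarrow> b"
  shows "conv_in_prob M (\<lambda>k w. Z k w * \<alpha> k) (a * b)"
proof -
  have "conv_in_prob M (\<lambda>k w. (Z k w - a) * \<alpha> k) 0"
    using conv lim meas
    by (intro conv_in_prob_0_mult_bounded prob
          conv_in_prob_imp_bounded_in_prob[OF prob _ conv_in_prob_deterministic])
       (simp_all add: conv_in_prob_shift)
  from conv_in_prob_add[OF prob _ _ this conv_in_prob_deterministic[OF tendsto_mult_left[OF lim, of a]]]
  show ?thesis
    using meas by (simp add: algebra_simps)
qed

section \<open>Measurability and characteristic functions for the two-part sample\<close>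

lemma measurable_estimate:
  assumes "T m \<in> borel_measurable (Pi\<^sub>M {1..m} (\<lambda>_. D))"
    and "\<And>i. i \<in> {1..m} \<Longrightarrow> Z i \<in> measurable M D"
  shows "(\<lambda>w. estimate T m (\<lambda>i. Z i w)) \<in> borel_measurable M"
  unfolding estimate_def
  by (rule measurable_compose[OF measurable_restrict assms(1)]) (rule assms(2))

lemma semisupervised_sampleD:
  assumes "semisupervised_sample M SX SY P n N X Y"
  shows "prob_space M"
    and "prob_space.indep_vars M (\<lambda>_. SX \<Otimes>\<^sub>M SY) (\<lambda>i w. (X i w, Y i w)) {1..n}"
    and "\<And>i. i \<in> {1..n} \<Longrightarrow> distr M (SX \<Otimes>\<^sub>M SY) (\<lambda>w. (X i w, Y i w)) = P"
    and "prob_space.indep_vars M (\<lambda>_. SX) X {n+1..n+N}"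
    and "\<And>i. i \<in> {n+1..n+N} \<Longrightarrow> distr M SX (X i) = distr P SX fst"
    and "prob_space.indep_set M
       (sets (vimage_algebra (space M) (\<lambda>w. \<lambda>i\<in>{1..n}. (X i w, Y i w)) (Pi\<^sub>M {1..n} (\<lambda>_. SX \<Otimes>\<^sub>M SY))))
       (sets (vimage_algebra (space M) (\<lambda>w. \<lambda>i\<in>{n+1..n+N}. X i w) (Pi\<^sub>M {n+1..n+N} (\<lambda>_. SX))))"
  using assms unfolding semisupervised_sample_def by auto

text \<open>Measurability is contained in \<open>indep_vars\<close>; for a labeled index
  \<open>X i\<close> is the first component of a measurable pair.\<close>

lemma semisupervised_sample_measurable:
  assumes S: "semisupervised_sample M SX SY P n N X Y"
  shows "i \<in> {1..n} \<Longrightarrow> (\<lambda>w. (X i w, Y i w)) \<in> measurable M (SX \<Otimes>\<^sub>M SY)"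
    and "i \<in> {1..n+N} \<Longrightarrow> X i \<in> measurable M SX"
proof -
  interpret prob_space M by (rule semisupervised_sampleD(1)[OF S])
  show *: "(\<lambda>w. (X i w, Y i w)) \<in> measurable M (SX \<Otimes>\<^sub>M SY)" if "i \<in> {1..n}" for i
    using semisupervised_sampleD(2)[OF S] that by (simp add: indep_vars_def2)
  show "X i \<in> measurable M SX" if "i \<in> {1..n+N}"
  proof (cases "i \<le> n")
    case True
    with measurable_compose[OF * measurable_fst, of i] that show ?thesis by simp
  next
    case False
    with semisupervised_sampleD(4)[OF S] that show ?thesis by (simp add: indep_vars_def2)
  qed
qed

text \<open>Independence of the two blocks gives the product, and the i.i.d. structure within each
  block gives the powers. The right-hand side sees the experiment only through \<open>P\<close> and
  the sample sizes, which is what makes changing spaces harmless.\<close>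

lemma char_semisupervised_sum:
  assumes S: "semisupervised_sample M SX SY P n N X Y"
    and P: "sets P = sets (SX \<Otimes>\<^sub>M SY)"
    and g: "g \<in> borel_measurable (SX \<Otimes>\<^sub>M SY)" and h: "h \<in> borel_measurable SX"
  shows "char (distr M borel (\<lambda>w. a * (\<Sum>i=1..n. g (X i w, Y i w)) + b * (\<Sum>i=n+1..n+N. h (X i w)))) t
    = char (distr P borel g) (a * t) ^ n * char (distr P borel (\<lambda>z. h (fst z))) (b * t) ^ N"
proof -
  note [measurable] = g h
  interpret prob_space M by (rule semisupervised_sampleD(1)[OF S])
  let ?L = "Pi\<^sub>M {1..n} (\<lambda>_. SX \<Otimes>\<^sub>M SY)" and ?U = "Pi\<^sub>M {n+1..n+N} (\<lambda>_. SX)"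
  let ?F = "\<lambda>w. \<lambda>i\<in>{1..n}. (X i w, Y i w)" and ?G = "\<lambda>w. \<lambda>i\<in>{n+1..n+N}. X i w"
  have F: "?F \<in> measurable M ?L"
    by (intro measurable_restrict semisupervised_sample_measurable(1)[OF S])
  have G: "?G \<in> measurable M ?U"
    by (intro measurable_restrict semisupervised_sample_measurable(2)[OF S]) auto
  have u: "(\<lambda>d. a * (\<Sum>i=1..n. g (d i))) \<in> borel_measurable ?L"
    by measurable
  have v: "(\<lambda>d. b * (\<Sum>i=n+1..n+N. h (d i))) \<in> borel_measurable ?U"
    by measurable
  have "indep_var borel (\<lambda>w. a * (\<Sum>i=1..n. g (X i w, Y i w))) borel (\<lambda>w. b * (\<Sum>i=n+1..n+N. h (X i w)))"
    using indep_var_if_indep_vimage_algebra[OF F G u v semisupervised_sampleD(6)[OF S]] by simp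
  then have "char (distr M borel (\<lambda>w. a * (\<Sum>i=1..n. g (X i w, Y i w)) + b * (\<Sum>i=n+1..n+N. h (X i w)))) t
    = char (distr M borel (\<lambda>w. a * (\<Sum>i=1..n. g (X i w, Y i w)))) t
      * char (distr M borel (\<lambda>w. b * (\<Sum>i=n+1..n+N. h (X i w)))) t"
    by (rule char_distr_add)
  also have "char (distr M borel (\<lambda>w. a * (\<Sum>i=1..n. g (X i w, Y i w)))) t
      = char (distr P borel g) (a * t) ^ n"
    using char_iid_sum[OF semisupervised_sampleD(2,3)[OF S] g, of a t] by simp
  also have "char (distr M borel (\<lambda>w. b * (\<Sum>i=n+1..n+N. h (X i w)))) t
      = char (distr (distr P SX fst) borel h) (b * t) ^ N"
    using char_iid_sum[OF semisupervised_sampleD(4,5)[OF S] h, of b t] by simp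
  also have "distr (distr P SX fst) borel h = distr P borel (\<lambda>z. h (fst z))"
    by (subst distr_distr) (auto simp: comp_def measurable_cong_sets[OF P refl])
  finally show ?thesis .
qed

text \<open>The product is dominated by the sum of the squares. This is needed for the covariance of
  the two influence functions.\<close>

lemma integrable_mult_of_squares:
  fixes u v :: "'a \<Rightarrow> real"
  assumes [measurable]: "u \<in> borel_measurable M" "v \<in> borel_measurable M"
    and sq: "integrable M (\<lambda>x. (u x)\<^sup>2)" "integrable M (\<lambda>x. (v x)\<^sup>2)"
  shows "integrable M (\<lambda>x. u x * v x)"
proof (rule Bochner_Integration.integrable_bound)
  show "integrable M (\<lambda>x. (u x)\<^sup>2 + (v x)\<^sup>2)"
    using sq by simp
  have "\<bar>a * b\<bar> \<le> a\<^sup>2 + b\<^sup>2" for a b :: real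
  proof -
    have "2 * (\<bar>a\<bar> * \<bar>b\<bar>) \<le> a\<^sup>2 + b\<^sup>2"
      using sum_squares_bound[of "\<bar>a\<bar>" "\<bar>b\<bar>"] by (simp add: ac_simps)
    then show ?thesis
      unfolding abs_mult using mult_nonneg_nonneg[OF abs_ge_zero[of a] abs_ge_zero[of b]] by linarith
  qed
  then show "AE x in M. norm (u x * v x) \<le> norm ((u x)\<^sup>2 + (v x)\<^sup>2)"
    by simp
qed simp

section \<open>Asymptotic normality of the prediction-powered estimator\<close>

theorem proposition2p2:
  fixes M :: "nat \<Rightarrow> 'w measure"
    and SX :: "'x measure" and SY :: "'y measure" and P :: "('x \<times> 'y) measure"
    and n N :: "nat \<Rightarrow> nat" and lam :: real
    and X :: "nat \<Rightarrow> nat \<Rightarrow> 'w \<Rightarrow> 'x" and Y :: "nat \<Rightarrow> nat \<Rightarrow> 'w \<Rightarrow> 'y"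
    and f :: "'x \<Rightarrow> 'y"
    and \<theta> :: "('x \<times> 'y) measure \<Rightarrow> real"
    and T :: "nat \<Rightarrow> (nat \<Rightarrow> 'x \<times> 'y) \<Rightarrow> real"
    and \<phi> :: "'x \<times> 'y \<Rightarrow> real" and \<phi>f :: "'x \<Rightarrow> real"
    and \<omega>hat :: "nat \<Rightarrow> 'w \<Rightarrow> real"
  assumes P_prob: "prob_space P" and P_sets: "sets P = sets (SX \<Otimes>\<^sub>M SY)"
    and sample: "\<And>k. semisupervised_sample (M k) SX SY P (n k) (N k) (X k) (Y k)"
    and f_meas: "f \<in> measurable SX SY"
    and T_meas: "\<And>m. T m \<in> borel_measurable (Pi\<^sub>M {1..m} (\<lambda>_. SX \<Otimes>\<^sub>M SY))"
    and \<phi>_meas: "\<phi> \<in> borel_measurable (SX \<Otimes>\<^sub>M SY)"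
    and \<phi>_mean: "(\<integral>z. \<phi> z \<partial>P) = 0"
    and \<phi>_sq: "integrable P (\<lambda>z. (\<phi> z)\<^sup>2)"
    and \<phi>f_meas: "\<phi>f \<in> borel_measurable SX"
    and \<phi>f_mean: "(\<integral>z. \<phi>f (fst z) \<partial>P) = 0"
    and \<phi>f_sq: "integrable P (\<lambda>z. (\<phi>f (fst z))\<^sup>2)"
    and \<phi>f_nondeg: "(\<integral>z. (\<phi>f (fst z))\<^sup>2 \<partial>P) > 0"
    and n_lim: "filterlim n at_top sequentially"
    and N_lim: "filterlim N at_top sequentially"
    and lam_nonneg: "lam \<ge> 0"
    and ratio_lim: "(\<lambda>k. real (n k) / real (N k)) \<longlonglongrightarrow> lam"
    and linear_n:
      "small_op M (\<lambda>k. 1 / sqrt (real (n k)))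
         (\<lambda>k w. estimate T (n k) (\<lambda>i. (X k i w, Y k i w)) - \<theta> P
                 - (1 / real (n k)) * (\<Sum>i=1..n k. \<phi> (X k i w, Y k i w)))"
    and linear_f_n:
      "small_op M (\<lambda>k. 1 / sqrt (real (n k)))
         (\<lambda>k w. estimate T (n k) (\<lambda>i. (X k i w, f (X k i w)))
                 - \<theta> (distr P (SX \<Otimes>\<^sub>M SY) (\<lambda>z. (fst z, f (fst z))))
                 - (1 / real (n k)) * (\<Sum>i=1..n k. \<phi>f (X k i w)))"
    and linear_f_nN:
      "small_op M (\<lambda>k. 1 / sqrt (real (n k)))
         (\<lambda>k w. estimate T (n k + N k) (\<lambda>i. (X k i w, f (X k i w)))
                 - \<theta> (distr P (SX \<Otimes>\<^sub>M SY) (\<lambda>z. (fst z, f (fst z))))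
                 - (1 / real (n k + N k)) * (\<Sum>i=1..n k + N k. \<phi>f (X k i w)))"
    and \<omega>hat_meas: "\<And>k. \<omega>hat k \<in> borel_measurable (M k)"
    and \<omega>hat_lim:
      "conv_in_prob M \<omega>hat ((\<integral>z. \<phi> z * \<phi>f (fst z) \<partial>P) / (\<integral>z. (\<phi>f (fst z))\<^sup>2 \<partial>P))"
  shows "weak_conv_m
    (\<lambda>k. distr (M k) borel
      (\<lambda>w. sqrt (real (n k))
            * (pp_estimate T f (n k) (N k) (\<lambda>i. X k i w) (\<lambda>i. Y k i w) (\<omega>hat k w) - \<theta> P)))
    (normal_law 0
      ((\<integral>z. (\<phi> z)\<^sup>2 \<partial>P)
        - (\<integral>z. \<phi> z * \<phi>f (fst z) \<partial>P)\<^sup>2 / ((1 + lam) * (\<integral>z. (\<phi>f (fst z))\<^sup>2 \<partial>P))))"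
proof -
  define PF where "PF = (\<integral>z. \<phi> z * \<phi>f (fst z) \<partial>P)"
  define S where "S = (\<integral>z. (\<phi>f (fst z))\<^sup>2 \<partial>P)"
  define \<omega> where "\<omega> = PF / S"
  define \<tau> where "\<tau> = 1 / (1 + lam)"
  define c where "c = sqrt lam / (1 + lam)"
  \<comment> \<open>\<open>\<tau>s\<close> and \<open>cs\<close> are the exact coefficients at
    finite sample sizes. The main term \<open>L\<close> uses their limits \<open>\<tau>\<close> and
    \<open>c\<close>, so that its summands \<open>g\<close> and \<open>h\<close> do not depend on
    \<open>k\<close>.\<close>
  define \<tau>s where "\<tau>s k = real (N k) / real (n k + N k)" for k
  define cs where "cs k = sqrt (real (n k)) * sqrt (real (N k)) / real (n k + N k)" for k
  define g where "g z = \<phi> z - \<omega> * \<tau> * \<phi>f (fst z)" for z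
  define h where "h x = \<omega> * c * \<phi>f x" for x
  define A where "A k w = 1 / sqrt (real (n k)) * (\<Sum>i=1..n k. \<phi>f (X k i w))" for k w
  define B where "B k w = 1 / sqrt (real (N k)) * (\<Sum>i=n k+1..n k+N k. \<phi>f (X k i w))" for k w
  define L where "L k w = 1 / sqrt (real (n k)) * (\<Sum>i=1..n k. g (X k i w, Y k i w))
      + 1 / sqrt (real (N k)) * (\<Sum>i=n k+1..n k+N k. h (X k i w))" for k w
  define \<theta>f where "\<theta>f = \<theta> (distr P (SX \<Otimes>\<^sub>M SY) (\<lambda>z. (fst z, f (fst z))))"
  \<comment> \<open>The scaling is that of \<open>small_op\<close>, so the linearity assumptions say
    directly that \<open>r1\<close>, \<open>r2\<close> and \<open>r3\<close> tend to 0 in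
    probability. The common centring \<open>\<theta>f\<close> cancels in
    \<open>r3 - r2\<close>.\<close>
  define r1 where "r1 k w = (estimate T (n k) (\<lambda>i. (X k i w, Y k i w)) - \<theta> P
      - (1 / real (n k)) * (\<Sum>i=1..n k. \<phi> (X k i w, Y k i w))) / (1 / sqrt (real (n k)))" for k w
  define r2 where "r2 k w = (estimate T (n k) (\<lambda>i. (X k i w, f (X k i w))) - \<theta>f
      - (1 / real (n k)) * (\<Sum>i=1..n k. \<phi>f (X k i w))) / (1 / sqrt (real (n k)))" for k w
  define r3 where "r3 k w = (estimate T (n k + N k) (\<lambda>i. (X k i w, f (X k i w))) - \<theta>f
      - (1 / real (n k + N k)) * (\<Sum>i=1..n k+N k. \<phi>f (X k i w))) / (1 / sqrt (real (n k)))" for k w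
  \<comment> \<open>The first line holds the linearisation errors, the second the cost of replacing
    random coefficients by their limits. Minus signs are written as negated summands to fit
    \<open>conv_in_prob_add\<close> and \<open>conv_in_prob_minus\<close>.\<close>
  define R where "R k w = r1 k w + (r3 k w + - r2 k w) * \<omega>hat k w
      + (- ((\<omega>hat k w * \<tau>s k - \<omega> * \<tau>) * A k w) + (\<omega>hat k w * cs k - \<omega> * c) * B k w)" for k w
  define Z where "Z k w = sqrt (real (n k))
      * (pp_estimate T f (n k) (N k) (\<lambda>i. X k i w) (\<lambda>i. Y k i w) (\<omega>hat k w) - \<theta> P)" for k w

  interpret P: prob_space P by (rule P_prob)
  have prob: "prob_space (M k)" for k
    by (rule semisupervised_sampleD(1)[OF sample])
  note [measurable] = \<phi>_meas \<phi>f_meas f_meas \<omega>hat_meas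
  note [measurable_cong] = P_sets
  have g_meas[measurable]: "g \<in> borel_measurable (SX \<Otimes>\<^sub>M SY)" unfolding g_def by measurable
  have h_meas[measurable]: "h \<in> borel_measurable SX" unfolding h_def by measurable
  have XY: "(\<lambda>w. (X k i w, Y k i w)) \<in> measurable (M k) (SX \<Otimes>\<^sub>M SY)" if "i \<in> {1..n k}" for k i
    by (rule semisupervised_sample_measurable(1)[OF sample that])
  have X: "X k i \<in> measurable (M k) SX" if "i \<in> {1..n k+N k}" for k i
    by (rule semisupervised_sample_measurable(2)[OF sample that])
  have Xf: "(\<lambda>w. (X k i w, f (X k i w))) \<in> measurable (M k) (SX \<Otimes>\<^sub>M SY)" if "i \<in> {1..n k+N k}" for k i
    using X[OF that] by measurable
  have est[measurable]:
    "(\<lambda>w. estimate T (n k) (\<lambda>i. (X k i w, Y k i w))) \<in> borel_measurable (M k)"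
    "(\<lambda>w. estimate T (n k) (\<lambda>i. (X k i w, f (X k i w)))) \<in> borel_measurable (M k)"
    "(\<lambda>w. estimate T (n k + N k) (\<lambda>i. (X k i w, f (X k i w)))) \<in> borel_measurable (M k)" for k
    by (rule measurable_estimate[OF T_meas], rule XY Xf, simp)+
  have sums[measurable]:
    "(\<lambda>w. \<Sum>i=1..n k. q (X k i w, Y k i w)) \<in> borel_measurable (M k)"
    if "q \<in> borel_measurable (SX \<Otimes>\<^sub>M SY)" for k and q :: "_ \<Rightarrow> real"
    by (intro borel_measurable_sum measurable_compose[OF XY that])
  have sumX[measurable]:
    "(\<lambda>w. \<Sum>i=1..n k. q (X k i w)) \<in> borel_measurable (M k)"
    "(\<lambda>w. \<Sum>i=n k+1..n k+N k. q (X k i w)) \<in> borel_measurable (M k)"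
    "(\<lambda>w. \<Sum>i=1..n k+N k. q (X k i w)) \<in> borel_measurable (M k)"
    if "q \<in> borel_measurable SX" for k and q :: "_ \<Rightarrow> real"
    by (intro borel_measurable_sum measurable_compose[OF X that]; simp)+
  have A_meas[measurable]: "A k \<in> borel_measurable (M k)" for k
    unfolding A_def using sumX[OF \<phi>f_meas] by measurable
  have B_meas[measurable]: "B k \<in> borel_measurable (M k)" for k
    unfolding B_def using sumX[OF \<phi>f_meas] by measurable
  have L_meas[measurable]: "L k \<in> borel_measurable (M k)" for k
    unfolding L_def using sumX[OF h_meas] sums[OF g_meas] by measurable
  have r_meas[measurable]: "r1 k \<in> borel_measurable (M k)" "r2 k \<in> borel_measurable (M k)"
      "r3 k \<in> borel_measurable (M k)" for k
    unfolding r1_def r2_def r3_def using sumX[OF \<phi>f_meas] sums[OF \<phi>_meas] by measurable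
  have R_meas[measurable]: "R k \<in> borel_measurable (M k)" for k
    unfolding R_def by measurable
  have Z_meas[measurable]: "Z k \<in> borel_measurable (M k)" for k
    unfolding Z_def pp_estimate_def by measurable

  \<comment> \<open>Division by 0 yields 0 here, so the algebraic identities below are claimed only
    for positive sample sizes, which hold eventually.\<close>
  have pos: "\<forall>\<^sub>F k in sequentially. n k > 0 \<and> N k > 0"
    using n_lim[unfolded filterlim_at_top, rule_format, of 1] N_lim[unfolded filterlim_at_top, rule_format, of 1]
    by eventually_elim simp
  have ratio: "N k > 0 \<Longrightarrow> \<tau>s k = 1 / (1 + real (n k) / real (N k))"
      "N k > 0 \<Longrightarrow> cs k = sqrt (real (n k) / real (N k)) / (1 + real (n k) / real (N k))" for k
  proof -
    assume "N k > 0"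
    then show "\<tau>s k = 1 / (1 + real (n k) / real (N k))"
      by (simp add: \<tau>s_def field_simps)
    have "sqrt (real (N k)) * sqrt (real (N k)) = real (N k)" by simp
    with \<open>N k > 0\<close> show "cs k = sqrt (real (n k) / real (N k)) / (1 + real (n k) / real (N k))"
      unfolding cs_def real_sqrt_divide by (simp add: divide_simps) (simp add: algebra_simps)
  qed
  have \<tau>_lim: "\<tau>s \<longlonglongrightarrow> \<tau>"
  proof (rule Lim_transform_eventually)
    show "(\<lambda>k. 1 / (1 + real (n k) / real (N k))) \<longlonglongrightarrow> \<tau>"
      unfolding \<tau>_def using lam_nonneg by (intro tendsto_intros ratio_lim) auto
    show "\<forall>\<^sub>F k in sequentially. 1 / (1 + real (n k) / real (N k)) = \<tau>s k"
      using pos by eventually_elim (simp add: ratio)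
  qed
  have c_lim: "cs \<longlonglongrightarrow> c"
  proof (rule Lim_transform_eventually)
    show "(\<lambda>k. sqrt (real (n k) / real (N k)) / (1 + real (n k) / real (N k))) \<longlonglongrightarrow> c"
      unfolding c_def using lam_nonneg by (intro tendsto_intros ratio_lim) auto
    show "\<forall>\<^sub>F k in sequentially. sqrt (real (n k) / real (N k)) / (1 + real (n k) / real (N k)) = cs k"
      using pos by eventually_elim (simp add: ratio)
  qed

  have decomp: "Z k w = L k w + R k w" if "n k > 0" "N k > 0" for k w
  proof -
    define s q where "s = sqrt (real (n k))" and "q = sqrt (real (N k))"
    have s: "s > 0" "real (n k) = s * s" and q: "q > 0" "real (N k) = q * q"
      using that by (auto simp: s_def q_def)
    have nN: "real (n k + N k) = s * s + q * q" "s * s + q * q \<noteq> 0"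
      using s q by (auto simp: add_pos_pos)
    define a b d where "a = (\<Sum>i=1..n k. \<phi> (X k i w, Y k i w))"
      and "b = (\<Sum>i=1..n k. \<phi>f (X k i w))" and "d = (\<Sum>i=n k+1..n k+N k. \<phi>f (X k i w))"
    have sum: "(\<Sum>i=1..n k+N k. \<phi>f (X k i w)) = b + d"
      unfolding b_def d_def by (rule sum.ub_add_nat) simp
    have L: "L k w = (a - \<omega> * \<tau> * b) / s + \<omega> * c * d / q"
      unfolding L_def g_def h_def s_def[symmetric] q_def[symmetric] a_def b_def d_def
      by (simp add: sum_subtractf sum_distrib_left[symmetric])
    \<comment> \<open>Naming the total size keeps it a single symbol in denominators;
      \<open>q * q\<close> is then eliminated in favour of \<open>D - s * s\<close>.\<close>
    define D where "D = s * s + q * q"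
    have D: "D \<noteq> 0" "q * q = D - s * s" using nN(2) by (simp_all add: D_def)
    have \<tau>s: "\<tau>s k = 1 - s * s / D"
      unfolding \<tau>s_def q(2) nN(1) D_def[symmetric] using D by (simp add: D(2) diff_divide_distrib)
    have cs: "cs k = s * q / D"
      unfolding cs_def nN(1) D_def[symmetric] s_def[symmetric] q_def[symmetric] ..
    \<comment> \<open>The key identity: the difference of the pooled and the labeled mean of
      \<open>\<phi>f\<close>, scaled by \<open>sqrt n\<close>, equals
      \<open>- \<tau>s * A + cs * B\<close>. It separates the overlapping samples into the two
      independent blocks.\<close>
    have coeff: "- \<tau>s k * (b / s) + cs k * (d / q) = s * ((b + d) / D - b / (s * s))"
      unfolding \<tau>s cs using s q D(1) by (simp add: field_simps)
    have R: "R k w = s * (estimate T (n k) (\<lambda>i. (X k i w, Y k i w)) - \<theta> P - a / (s * s))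
      + s * (estimate T (n k + N k) (\<lambda>i. (X k i w, f (X k i w))) - estimate T (n k) (\<lambda>i. (X k i w, f (X k i w)))
          - ((b + d) / D - b / (s * s))) * \<omega>hat k w
      + (\<omega> * \<tau> * (b / s) - \<omega> * c * (d / q) + \<omega>hat k w * (- \<tau>s k * (b / s) + cs k * (d / q)))"
      unfolding R_def r1_def r2_def r3_def A_def B_def sum s_def[symmetric] q_def[symmetric]
        a_def[symmetric] b_def[symmetric] d_def[symmetric]
      unfolding s(2) nN(1) D_def[symmetric]
      by (simp add: algebra_simps)
    show ?thesis
      unfolding L R coeff unfolding Z_def pp_estimate_def s_def[symmetric]
      using s by (simp add: algebra_simps diff_divide_distrib)
  qed

  \<comment> \<open>Negligibility of the remainder\<close>
  have A_bdd: "bounded_in_prob M A"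
  proof (rule bounded_in_prob_second_moment[OF prob A_meas])
    fix k
    interpret prob_space "M k" by (rule prob)
    note iid = iid_centered_sum[OF finite_atLeastAtMost semisupervised_sampleD(2,3)[OF sample[of k]], of "\<lambda>z. \<phi>f (fst z)"]
    show "integrable (M k) (\<lambda>w. (A k w)\<^sup>2)"
      unfolding A_def power_mult_distrib using iid(1) \<phi>f_sq \<phi>f_mean by simp
    \<comment> \<open>Equality holds for a nonempty labeled sample; for an empty one the left side
      is 0, hence an inequality.\<close>
    show "(\<integral>w. (A k w)\<^sup>2 \<partial>M k) \<le> S"
      unfolding A_def power_mult_distrib using iid(2) \<phi>f_sq \<phi>f_mean \<phi>f_nondeg
      by (simp add: S_def power_divide)
  qed
  have B_bdd: "bounded_in_prob M B"
  proof (rule bounded_in_prob_second_moment[OF prob B_meas])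
    fix k
    interpret prob_space "M k" by (rule prob)
    \<comment> \<open>The unlabeled points follow the marginal law of \<open>P\<close>, so the
      moment assumptions are first transported along \<open>fst\<close>.\<close>
    have Q: "integrable (distr P SX fst) (\<lambda>x. (\<phi>f x)\<^sup>2)" "(\<integral>x. \<phi>f x \<partial>distr P SX fst) = 0"
        "(\<integral>x. (\<phi>f x)\<^sup>2 \<partial>distr P SX fst) = S"
      using \<phi>f_sq \<phi>f_mean by (simp_all add: integrable_distr_eq integral_distr S_def)
    note iid = iid_centered_sum[OF finite_atLeastAtMost semisupervised_sampleD(4,5)[OF sample[of k]] \<phi>f_meas Q(1,2)]
    show "integrable (M k) (\<lambda>w. (B k w)\<^sup>2)"
      unfolding B_def power_mult_distrib using iid(1) by simp
    show "(\<integral>w. (B k w)\<^sup>2 \<partial>M k) \<le> S"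
      unfolding B_def power_mult_distrib using iid(2) \<phi>f_nondeg Q(3)
      by (simp add: S_def power_divide)
  qed

  have \<omega>_lim: "conv_in_prob M \<omega>hat \<omega>"
    using \<omega>hat_lim by (simp add: \<omega>_def PF_def S_def)
  have r_conv: "conv_in_prob M r1 0" "conv_in_prob M r2 0" "conv_in_prob M r3 0"
    using linear_n linear_f_n linear_f_nN
    unfolding small_op_def r1_def r2_def r3_def \<theta>f_def by simp_all
  have r_diff: "conv_in_prob M (\<lambda>k w. r3 k w + - r2 k w) 0"
    using conv_in_prob_add[OF prob _ _ r_conv(3) conv_in_prob_minus[OF r_conv(2)]] by simp
  have part1: "conv_in_prob M (\<lambda>k w. (r3 k w + - r2 k w) * \<omega>hat k w) 0"
    by (rule conv_in_prob_0_mult_bounded[OF prob _ _ r_diff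
          conv_in_prob_imp_bounded_in_prob[OF prob \<omega>hat_meas \<omega>_lim]]) measurable
  have part2: "conv_in_prob M (\<lambda>k w. r1 k w + (r3 k w + - r2 k w) * \<omega>hat k w) 0"
    using conv_in_prob_add[OF prob _ _ r_conv(1) part1] by simp
  have part3: "conv_in_prob M (\<lambda>k w. (\<omega>hat k w * \<tau>s k - \<omega> * \<tau>) * A k w) 0"
    by (rule conv_in_prob_0_mult_bounded[OF prob _ _ _ A_bdd])
       (simp_all add: conv_in_prob_shift conv_in_prob_mult_deterministic[OF prob \<omega>hat_meas \<omega>_lim \<tau>_lim])
  have part4: "conv_in_prob M (\<lambda>k w. (\<omega>hat k w * cs k - \<omega> * c) * B k w) 0"
    by (rule conv_in_prob_0_mult_bounded[OF prob _ _ _ B_bdd])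
       (simp_all add: conv_in_prob_shift conv_in_prob_mult_deterministic[OF prob \<omega>hat_meas \<omega>_lim c_lim])
  have part5: "conv_in_prob M (\<lambda>k w. - ((\<omega>hat k w * \<tau>s k - \<omega> * \<tau>) * A k w)
      + (\<omega>hat k w * cs k - \<omega> * c) * B k w) 0"
    using conv_in_prob_add[OF prob _ _ conv_in_prob_minus[OF part3] part4] by simp
  have R_conv: "conv_in_prob M R 0"
    using conv_in_prob_add[OF prob _ _ part2 part5] unfolding R_def by simp

  \<comment> \<open>Variance of the main term\<close>
  have int_mult: "integrable P (\<lambda>z. \<phi> z * \<phi>f (fst z))"
    by (rule integrable_mult_of_squares[OF _ _ \<phi>_sq \<phi>f_sq]) measurable
  have int1: "integrable P \<phi>" "integrable P (\<lambda>z. \<phi>f (fst z))"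
    by (rule P.square_integrable_imp_integrable[OF _ \<phi>_sq], measurable)
       (rule P.square_integrable_imp_integrable[OF _ \<phi>f_sq], measurable)
  have g_sq_eq: "(g z)\<^sup>2 = (\<phi> z)\<^sup>2 - 2 * \<omega> * \<tau> * (\<phi> z * \<phi>f (fst z)) + (\<omega> * \<tau>)\<^sup>2 * (\<phi>f (fst z))\<^sup>2" for z
    unfolding g_def by (simp add: power2_diff power_mult_distrib)
  have g_sq: "integrable P (\<lambda>z. (g z)\<^sup>2)"
      "(\<integral>z. (g z)\<^sup>2 \<partial>P) = (\<integral>z. (\<phi> z)\<^sup>2 \<partial>P) - 2 * \<omega> * \<tau> * PF + (\<omega> * \<tau>)\<^sup>2 * S"
    unfolding g_sq_eq using \<phi>_sq \<phi>f_sq int_mult by (simp_all add: PF_def S_def)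
  have g_mean: "(\<integral>z. g z \<partial>P) = 0"
    unfolding g_def using int1 \<phi>_mean \<phi>f_mean by simp
  have h_sq: "integrable P (\<lambda>z. (h (fst z))\<^sup>2)" "(\<integral>z. (h (fst z))\<^sup>2 \<partial>P) = (\<omega> * c)\<^sup>2 * S"
    unfolding h_def power_mult_distrib using \<phi>f_sq by (simp_all add: S_def)
  have h_mean: "(\<integral>z. h (fst z) \<partial>P) = 0"
    unfolding h_def using \<phi>f_mean by simp
  \<comment> \<open>As a sum of integrals of squares the limiting variance is visibly nonnegative;
    the closed form is derived afterwards.\<close>
  define v where "v = (\<integral>z. (g z)\<^sup>2 \<partial>P) + (\<integral>z. (h (fst z))\<^sup>2 \<partial>P)"
  have v_nonneg: "v \<ge> 0" unfolding v_def by (intro add_nonneg_nonneg) simp_all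
  have v_eq: "v = (\<integral>z. (\<phi> z)\<^sup>2 \<partial>P) - PF\<^sup>2 / ((1 + lam) * S)"
  proof -
    have S: "S > 0" using \<phi>f_nondeg by (simp add: S_def)
    have c2: "c\<^sup>2 = lam / (1 + lam)\<^sup>2"
      using lam_nonneg by (simp add: c_def power_divide)
    have "\<tau>\<^sup>2 + c\<^sup>2 = \<tau>"
      unfolding c2 \<tau>_def using lam_nonneg by (simp add: power_divide add_divide_distrib[symmetric] power2_eq_square)
    moreover have "PF = \<omega> * S" using S by (simp add: \<omega>_def)
    moreover have "v = (\<integral>z. (\<phi> z)\<^sup>2 \<partial>P) - 2 * \<omega> * \<tau> * PF + \<omega>\<^sup>2 * S * (\<tau>\<^sup>2 + c\<^sup>2)"
      unfolding v_def g_sq(2) h_sq(2) by (simp add: power_mult_distrib algebra_simps)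
    \<comment> \<open>With \<open>PF = \<omega> * S\<close>, the cross term is minus twice
      \<open>\<omega>\<^sup>2 * S * \<tau>\<close>, and the quadratic terms give that quantity back
      once.\<close>
    ultimately have "v = (\<integral>z. (\<phi> z)\<^sup>2 \<partial>P) - \<omega>\<^sup>2 * S * \<tau>"
      by (simp add: power2_eq_square)
    moreover have "\<omega>\<^sup>2 * S * \<tau> = PF\<^sup>2 / ((1 + lam) * S)"
      using S by (simp add: \<omega>_def \<tau>_def power_divide power2_eq_square)
    ultimately show ?thesis by simp
  qed

  \<comment> \<open>Passage to the limit\<close>
  have char_L: "(\<lambda>k. char (distr (M k) borel (L k)) t) \<longlonglongrightarrow> char (normal_law 0 v) t" for t
  proof -
    have law: "(\<lambda>m. char (distr P borel q) (t / sqrt (real m)) ^ m)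
        \<longlonglongrightarrow> complex_of_real (exp (- ((\<integral>z. (q z)\<^sup>2 \<partial>P) * t\<^sup>2) / 2))"
      if [measurable]: "q \<in> borel_measurable P" and "(\<integral>z. q z \<partial>P) = 0" "integrable P (\<lambda>z. (q z)\<^sup>2)" for q
      using char_power_tendsto[of "distr P borel q" t] that by (simp add: integral_distr integrable_distr_eq)
    have "(\<lambda>k. char (distr P borel g) (t / sqrt (real (n k))) ^ n k
          * char (distr P borel (\<lambda>z. h (fst z))) (t / sqrt (real (N k))) ^ N k)
        \<longlonglongrightarrow> complex_of_real (exp (- ((\<integral>z. (g z)\<^sup>2 \<partial>P) * t\<^sup>2) / 2))
          * complex_of_real (exp (- ((\<integral>z. (h (fst z))\<^sup>2 \<partial>P) * t\<^sup>2) / 2))"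
      by (intro tendsto_mult filterlim_compose[OF law n_lim] filterlim_compose[OF law N_lim]
            g_mean g_sq(1) h_mean h_sq(1)) measurable
    also have "complex_of_real (exp (- ((\<integral>z. (g z)\<^sup>2 \<partial>P) * t\<^sup>2) / 2))
          * complex_of_real (exp (- ((\<integral>z. (h (fst z))\<^sup>2 \<partial>P) * t\<^sup>2) / 2)) = char (normal_law 0 v) t"
      unfolding char_normal_law_0[OF v_nonneg] unfolding v_def of_real_mult[symmetric] exp_add[symmetric]
      by (simp add: field_simps)
    finally show ?thesis
      unfolding L_def char_semisupervised_sum[OF sample P_sets g_meas h_meas] by simp
  qed
  have "weak_conv_m (\<lambda>k. distr (M k) borel (Z k)) (normal_law 0 v)"
  proof (rule levy_continuity)
    show "real_distribution (distr (M k) borel (Z k))" for k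
      by (rule prob_space.real_distribution_distr[OF prob Z_meas])
    show "real_distribution (normal_law 0 v)"
      by (rule real_distribution_normal_law[OF v_nonneg])
    fix t
    have "(\<lambda>k. char (distr (M k) borel (\<lambda>w. L k w + R k w)) t) \<longlonglongrightarrow> char (normal_law 0 v) t"
      using tendsto_add[OF char_add_conv_in_prob_0[OF prob L_meas R_meas R_conv, of t] char_L[of t]]
      by simp
    \<comment> \<open>The decomposition is an identity of functions once both sample sizes are
      positive, so the two sequences of characteristic functions eventually agree.\<close>
    moreover have "\<forall>\<^sub>F k in sequentially.
        char (distr (M k) borel (\<lambda>w. L k w + R k w)) t = char (distr (M k) borel (Z k)) t"
      using pos
    proof eventually_elim
      case (elim k)
      then have "(\<lambda>w. L k w + R k w) = Z k" by (simp add: decomp fun_eq_iff)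
      then show ?case by simp
    qed
    ultimately show "(\<lambda>k. char (distr (M k) borel (Z k)) t) \<longlonglongrightarrow> char (normal_law 0 v) t"
      by (rule Lim_transform_eventually)
  qed
  then show ?thesis
    unfolding Z_def v_eq PF_def S_def .
qed

end
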